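(* Let $\beta>0$, and consider the objective function $$L(\theta,\phi)=\mathbb{E}_{X\sim P(X),\,Z\sim P_{\phi}(Z|X)}[J(Z;\theta)]-\beta I(X,Z;\phi).$$ Fix a policy-value parameter $\theta$, a representation distribution $P_{\phi}(Z|X)$ and a state distribution $P(X)$. Define a new representation distribution $P_{\hat\phi}(Z|X)$ by $$P_{\hat{\phi}}(Z|X)\propto P_{\phi}(Z)\exp\Big(\frac{1}{\beta}J(Z;\theta)\Big),$$ that is, the right-hand side normalized to be a probability density in $Z$ for each $X$. Then $L(\theta,\hat{\phi})\ge L(\theta,\phi)$.
   Context: $X$ is a random state with distribution (density) $P(X)$ on a state space, and $P_{\phi}(Z|X)$ is a conditional distribution (density) of a representation $Z$ given $X$. The marginal of $Z$ is $P_{\phi}(Z)=\int P(X)P_{\phi}(Z|X)\,dX$, and the mutual information is $$I(X,Z;\phi)=\mathbb{E}_{X\sim P(X),\,Z\sim P_{\phi}(Z|X)}\Big[\log\frac{P_{\phi}(Z|X)}{P_{\phi}(Z)}\Big].$$ The label $\hat\phi$ just denotes the new conditional distribution: $L(\theta,\hat\phi)$ and $I(X,Z;\hat\phi)$ are given by the same formulas with $P_{\phi}(Z|X)$ replaced by $P_{\hat\phi}(Z|X)$ and $P_{\phi}(Z)$ replaced by $P_{\hat\phi}(Z)=\int P(X)P_{\hat\phi}(Z|X)\,dX$, with $P(X)$ unchanged. $J(Z;\theta)$ is the reinforcement learning objective evaluated at representation $Z$ with policy-value parameter $\theta$, e.g. an actor-critic objective; it enters the statement only as a real-valued function of $(Z,\theta)$.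 The number $\beta$ is the coefficient of the mutual-information regularizer. The normalizing constant $\int P_{\phi}(Z)\exp(\frac{1}{\beta}J(Z;\theta))\,dZ$ and all expectations and mutual informations involved are assumed to be well defined and finite. *)

theory Defs
  imports "HOL-Probability.Probability"
begin

text \<open>Densities are real-valued and taken with respect to reference measures \<open>\<mu>\<close> (states)
  and \<open>\<nu>\<close> (representations), which covers the continuous as well as the discrete case.\<close>

definition prob_density :: "'a measure \<Rightarrow> ('a \<Rightarrow> real) \<Rightarrow> bool" where
  "prob_density M f \<longleftrightarrow>
     f \<in> borel_measurable M \<and> (\<forall>x\<in>space M. 0 \<le> f x) \<and> (\<integral>\<^sup>+x. ennreal (f x) \<partial>M) = 1"

definition cond_density :: "'x measure \<Rightarrow> 'z measure \<Rightarrow> ('x \<Rightarrow> 'z \<Rightarrow> real) \<Rightarrow> bool" where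
  "cond_density \<mu> \<nu> q \<longleftrightarrow>
     (\<lambda>(x, z). q x z) \<in> borel_measurable (\<mu> \<Otimes>\<^sub>M \<nu>) \<and> (\<forall>x\<in>space \<mu>. prob_density \<nu> (q x))"

text \<open>The joint law of \<open>(X, Z)\<close> with \<open>X \<sim> p\<close> and \<open>Z \<sim> q X\<close>.\<close>

definition joint_law ::
    "'x measure \<Rightarrow> 'z measure \<Rightarrow> ('x \<Rightarrow> real) \<Rightarrow> ('x \<Rightarrow> 'z \<Rightarrow> real) \<Rightarrow> ('x \<times> 'z) measure" where
  "joint_law \<mu> \<nu> p q = density (\<mu> \<Otimes>\<^sub>M \<nu>) (\<lambda>(x, z). ennreal (p x * q x z))"

text \<open>For \<open>z\<close> in a \<open>\<nu>\<close>-null set the integral may diverge; the Bochner integral is then \<open>0\<close>.\<close>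

definition marginal :: "'x measure \<Rightarrow> ('x \<Rightarrow> real) \<Rightarrow> ('x \<Rightarrow> 'z \<Rightarrow> real) \<Rightarrow> 'z \<Rightarrow> real" where
  "marginal \<mu> p q z = (\<integral>x. p x * q x z \<partial>\<mu>)"

text \<open>The value of \<open>ln\<close> at an argument with zero numerator or denominator is immaterial:
  such points form a null set of the joint law.\<close>

definition mutual_info ::
    "'x measure \<Rightarrow> 'z measure \<Rightarrow> ('x \<Rightarrow> real) \<Rightarrow> ('x \<Rightarrow> 'z \<Rightarrow> real) \<Rightarrow> real" where
  "mutual_info \<mu> \<nu> p q = (\<integral>(x, z). ln (q x z / marginal \<mu> p q z) \<partial>joint_law \<mu> \<nu> p q)"

text \<open>The representation parameter \<open>\<phi>\<close> enters only through the conditional density \<open>q\<close> of \<open>Z\<close>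
  given \<open>X\<close>, so \<open>q\<close> itself is the argument.\<close>

definition objective ::
    "'x measure \<Rightarrow> 'z measure \<Rightarrow> ('x \<Rightarrow> real) \<Rightarrow> ('z \<Rightarrow> 'th \<Rightarrow> real) \<Rightarrow> real
      \<Rightarrow> 'th \<Rightarrow> ('x \<Rightarrow> 'z \<Rightarrow> real) \<Rightarrow> real" where
  "objective \<mu> \<nu> p J \<beta> \<theta> q =
     (\<integral>(x, z). J z \<theta> \<partial>joint_law \<mu> \<nu> p q) - \<beta> * mutual_info \<mu> \<nu> p q"

text \<open>The Bochner integral is total, so finiteness of the expectation of \<open>J\<close> and of the
  mutual information has to be stated as integrability.\<close>

definition objective_finite ::
    "'x measure \<Rightarrow> 'z measure \<Rightarrow> ('x \<Rightarrow> real) \<Rightarrow> ('z \<Rightarrow> 'th \<Rightarrow> real)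
      \<Rightarrow> 'th \<Rightarrow> ('x \<Rightarrow> 'z \<Rightarrow> real) \<Rightarrow> bool" where
  "objective_finite \<mu> \<nu> p J \<theta> q \<longleftrightarrow>
     integrable (joint_law \<mu> \<nu> p q) (\<lambda>(x, z). J z \<theta>) \<and>
     integrable (joint_law \<mu> \<nu> p q) (\<lambda>(x, z). ln (q x z / marginal \<mu> p q z))"

definition tilted ::
    "'x measure \<Rightarrow> 'z measure \<Rightarrow> ('x \<Rightarrow> real) \<Rightarrow> ('z \<Rightarrow> 'th \<Rightarrow> real) \<Rightarrow> real
      \<Rightarrow> 'th \<Rightarrow> ('x \<Rightarrow> 'z \<Rightarrow> real) \<Rightarrow> 'x \<Rightarrow> 'z \<Rightarrow> real" where
  "tilted \<mu> \<nu> p J \<beta> \<theta> q x z =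
     marginal \<mu> p q z * exp (1 / \<beta> * J z \<theta>) /
     (\<integral>z'. marginal \<mu> p q z' * exp (1 / \<beta> * J z' \<theta>) \<partial>\<nu>)"

end

theory Submission
  imports Defs
begin

text \<open>The tilted law does not depend on the state, so its mutual information vanishes, while that
  of the original representation is nonnegative.  Hence it is enough that passing from a law with
  density \<open>m\<close> to the one proportional to \<open>m * exp (J / \<beta>)\<close> does not decrease the mean of \<open>J\<close>.
  With \<open>a\<close> the mean under \<open>m\<close>, this follows by integrating
  \<open>(J - a) * (exp (J / \<beta>) - exp (a / \<beta>)) \<ge> 0\<close> against \<open>m\<close>.\<close>

section \<open>Densities, and the mean of a function under exponential tilting\<close>

lemma prob_densityD:
  assumes "prob_density M f"
  shows "f \<in> borel_measurable M" and "\<And>x. x \<in> space M \<Longrightarrow> 0 \<le> f x"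
    and "(\<integral>\<^sup>+x. ennreal (f x) \<partial>M) = 1" and "integrable M f" and "(\<integral>x. f x \<partial>M) = 1"
proof -
  show m: "f \<in> borel_measurable M" and nonneg: "\<And>x. x \<in> space M \<Longrightarrow> 0 \<le> f x"
    and one: "(\<integral>\<^sup>+x. ennreal (f x) \<partial>M) = 1"
    using assms by (auto simp: prob_density_def)
  show "integrable M f"
    using m nonneg one by (intro integrableI_nonneg) auto
  show "(\<integral>x. f x \<partial>M) = 1"
    using m nonneg one by (subst integral_eq_nn_integral) auto
qed

lemma prob_densityI_integral:
  assumes "integrable M f" and "\<And>x. x \<in> space M \<Longrightarrow> 0 \<le> f x" and "(\<integral>x. f x \<partial>M) = 1"
  shows "prob_density M f"
  unfolding prob_density_def
  using assms by (auto simp: nn_integral_eq_integral)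

text \<open>A case of Chebyshev's correlation inequality: \<open>f\<close> and
  \<open>exp (1 / \<beta> * f)\<close> increase together, so they are nonnegatively correlated under
  the density \<open>m\<close>. Keeping the normalizing integral as a factor on the left avoids any
  division.\<close>

lemma tilted_mean_ge:
  fixes m f :: "'a \<Rightarrow> real"
  assumes m: "prob_density M m"
    and \<beta>: "\<beta> > 0"
    and int_f: "integrable M (\<lambda>x. m x * f x)"
    and int_exp: "integrable M (\<lambda>x. m x * exp (1 / \<beta> * f x))"
    and int_f_exp: "integrable M (\<lambda>x. m x * exp (1 / \<beta> * f x) * f x)"
  shows "(\<integral>x. m x * f x \<partial>M) * (\<integral>x. m x * exp (1 / \<beta> * f x) \<partial>M)
          \<le> (\<integral>x. m x * exp (1 / \<beta> * f x) * f x \<partial>M)"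
proof -
  note m = prob_densityD[OF m]
  define a where "a = (\<integral>x. m x * f x \<partial>M)"
  \<comment> \<open>With this \<open>k\<close>, both factors \<open>f x - a\<close> and
    \<open>exp (1 / \<beta> * f x) - k\<close> change sign at the same place,
    \<open>f x = a\<close>, so their product is never negative.\<close>
  define k where "k = exp (1 / \<beta> * a)"
  let ?e = "\<lambda>x. m x * exp (1 / \<beta> * f x)"
  have "0 \<le> (\<integral>x. m x * ((f x - a) * (exp (1 / \<beta> * f x) - k)) \<partial>M)"
  proof (rule Bochner_Integration.integral_nonneg)
    fix x assume "x \<in> space M"
    have "0 \<le> (f x - a) * (exp (1 / \<beta> * f x) - k)"
      using \<beta> by (cases "a \<le> f x")
        (auto simp: k_def divide_right_mono intro!: mult_nonneg_nonneg mult_nonpos_nonpos)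
    with m(2)[OF \<open>x \<in> space M\<close>] show "0 \<le> m x * ((f x - a) * (exp (1 / \<beta> * f x) - k))"
      by simp
  qed
  also have "\<dots> = (\<integral>x. ?e x * f x - a * ?e x - k * (m x * f x) + k * a * m x \<partial>M)"
    by (intro Bochner_Integration.integral_cong) (auto simp: algebra_simps)
  \<comment> \<open>Since \<open>a\<close> is the mean of \<open>f\<close> and \<open>m\<close>
    integrates to 1, the two terms in \<open>k\<close> cancel.\<close>
  also have "\<dots> = (\<integral>x. ?e x * f x \<partial>M) - a * (\<integral>x. ?e x \<partial>M) - k * a + k * a"
    using int_f int_exp int_f_exp m(4,5) by (simp add: a_def)
  finally show ?thesis
    by (simp add: a_def)
qed

section \<open>Joint law and marginal of a representation\<close>

locale representation = \<mu>: sigma_finite_measure \<mu> + \<nu>: sigma_finite_measure \<nu>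
  for \<mu> :: "'x measure" and \<nu> :: "'z measure" +
  fixes p :: "'x \<Rightarrow> real" and q :: "'x \<Rightarrow> 'z \<Rightarrow> real"
  assumes p: "prob_density \<mu> p" and q: "cond_density \<mu> \<nu> q"
begin

sublocale pair_sigma_finite \<mu> \<nu> ..

lemma p_measurable [measurable]: "p \<in> borel_measurable \<mu>"
  and p_nonneg: "x \<in> space \<mu> \<Longrightarrow> 0 \<le> p x"
  using prob_densityD[OF p] by auto

lemma q_measurable [measurable]: "(\<lambda>(x, z). q x z) \<in> borel_measurable (\<mu> \<Otimes>\<^sub>M \<nu>)"
  and q_prob_density: "x \<in> space \<mu> \<Longrightarrow> prob_density \<nu> (q x)"
  using q by (auto simp: cond_density_def)

lemma q_nonneg: "x \<in> space \<mu> \<Longrightarrow> z \<in> space \<nu> \<Longrightarrow> 0 \<le> q x z"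
  using prob_densityD(2)[OF q_prob_density] .

lemma marginal_measurable [measurable]: "marginal \<mu> p q \<in> borel_measurable \<nu>"
  unfolding marginal_def by measurable

lemma marginal_nonneg: "z \<in> space \<nu> \<Longrightarrow> 0 \<le> marginal \<mu> p q z"
  unfolding marginal_def by (intro Bochner_Integration.integral_nonneg) (simp add: p_nonneg q_nonneg)

lemma nn_integral_joint:
  "(\<integral>\<^sup>+z. (\<integral>\<^sup>+x. ennreal (p x * q x z) \<partial>\<mu>) \<partial>\<nu>) = 1"
proof -
  have "(\<integral>\<^sup>+z. (\<integral>\<^sup>+x. ennreal (p x * q x z) \<partial>\<mu>) \<partial>\<nu>)
      = (\<integral>\<^sup>+x. (\<integral>\<^sup>+z. ennreal (p x * q x z) \<partial>\<nu>) \<partial>\<mu>)"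
    by (intro Fubini') measurable
  also have "\<dots> = (\<integral>\<^sup>+x. ennreal (p x) \<partial>\<mu>)"
  proof (intro nn_integral_cong)
    fix x assume x: "x \<in> space \<mu>"
    have "(\<integral>\<^sup>+z. ennreal (p x * q x z) \<partial>\<nu>) = (\<integral>\<^sup>+z. ennreal (p x) * ennreal (q x z) \<partial>\<nu>)"
      using x by (intro nn_integral_cong) (simp add: ennreal_mult p_nonneg q_nonneg)
    also have "\<dots> = ennreal (p x)"
      using prob_densityD(1,3)[OF q_prob_density[OF x]] by (simp add: nn_integral_cmult)
    finally show "(\<integral>\<^sup>+z. ennreal (p x * q x z) \<partial>\<nu>) = ennreal (p x)" .
  qed
  finally show ?thesis
    using prob_densityD(3)[OF p] by simp
qed

text \<open>The nonnegative integral over states has total integral 1 over \<open>z\<close>, so it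
  is infinite only on a null set; elsewhere the Bochner integral in \<open>marginal\<close> agrees
  with it. The default value 0 of a divergent integral therefore does no harm.\<close>

lemma AE_nn_integral_eq_marginal:
  "AE z in \<nu>. (\<integral>\<^sup>+x. ennreal (p x * q x z) \<partial>\<mu>) = ennreal (marginal \<mu> p q z)"
proof -
  have "AE z in \<nu>. (\<integral>\<^sup>+x. ennreal (p x * q x z) \<partial>\<mu>) \<noteq> \<infinity>"
    by (rule nn_integral_PInf_AE) (simp_all add: nn_integral_joint)
  then show ?thesis
  proof (rule AE_mp, intro AE_I2 impI)
    fix z assume z: "z \<in> space \<nu>" and fin: "(\<integral>\<^sup>+x. ennreal (p x * q x z) \<partial>\<mu>) \<noteq> \<infinity>"
    have "(\<lambda>x. p x * q x z) \<in> borel_measurable \<mu>"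
      using z by measurable
    moreover have nonneg: "AE x in \<mu>. 0 \<le> p x * q x z"
      using z by (simp add: p_nonneg q_nonneg)
    ultimately have "integrable \<mu> (\<lambda>x. p x * q x z)"
      using fin by (intro integrableI_nonneg) (auto simp: less_top)
    then show "(\<integral>\<^sup>+x. ennreal (p x * q x z) \<partial>\<mu>) = ennreal (marginal \<mu> p q z)"
      unfolding marginal_def using nonneg by (rule nn_integral_eq_integral)
  qed
qed

lemma prob_density_marginal: "prob_density \<nu> (marginal \<mu> p q)"
  unfolding prob_density_def
  using nn_integral_cong_AE[OF AE_nn_integral_eq_marginal] nn_integral_joint marginal_nonneg
  by auto

lemma snd_measurable_joint_law [measurable]: "snd \<in> joint_law \<mu> \<nu> p q \<rightarrow>\<^sub>M \<nu>"
  by (simp add: joint_law_def)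

text \<open>Reduces expectations of functions of \<open>z\<close> alone to integrals over
  \<open>\<nu>\<close> weighted by the marginal. On a test set, Tonelli integrates the state out
  first, and the inner integral is almost everywhere the marginal.\<close>

lemma distr_joint_law_snd:
  "distr (joint_law \<mu> \<nu> p q) \<nu> snd = density \<nu> (\<lambda>z. ennreal (marginal \<mu> p q z))"
proof (rule measure_eqI)
  fix A assume "A \<in> sets (distr (joint_law \<mu> \<nu> p q) \<nu> snd)"
  then have A [measurable]: "A \<in> sets \<nu>"
    by simp
  have "emeasure (distr (joint_law \<mu> \<nu> p q) \<nu> snd) A = (\<integral>\<^sup>+z. indicator A z \<partial>distr (joint_law \<mu> \<nu> p q) \<nu> snd)"
    by simp
  also have "\<dots> = (\<integral>\<^sup>+w. indicator A (snd w) \<partial>joint_law \<mu> \<nu> p q)"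
    by (intro nn_integral_distr) measurable
  also have "\<dots> = (\<integral>\<^sup>+w. ennreal (p (fst w) * q (fst w) (snd w)) * indicator A (snd w) \<partial>(\<mu> \<Otimes>\<^sub>M \<nu>))"
    unfolding joint_law_def by (subst nn_integral_density) (auto simp: case_prod_unfold)
  also have "\<dots> = (\<integral>\<^sup>+z. (\<integral>\<^sup>+x. ennreal (p x * q x z) * indicator A z \<partial>\<mu>) \<partial>\<nu>)"
    by (subst nn_integral_snd[symmetric]) (auto simp: case_prod_unfold)
  also have "\<dots> = (\<integral>\<^sup>+z. (\<integral>\<^sup>+x. ennreal (p x * q x z) \<partial>\<mu>) * indicator A z \<partial>\<nu>)"
    by (intro nn_integral_cong nn_integral_multc) measurable
  also have "\<dots> = (\<integral>\<^sup>+z. ennreal (marginal \<mu> p q z) * indicator A z \<partial>\<nu>)"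
    using AE_nn_integral_eq_marginal by (intro nn_integral_cong_AE) auto
  also have "\<dots> = emeasure (density \<nu> (\<lambda>z. ennreal (marginal \<mu> p q z))) A"
    by (simp add: emeasure_density)
  finally show "emeasure (distr (joint_law \<mu> \<nu> p q) \<nu> snd) A
      = emeasure (density \<nu> (\<lambda>z. ennreal (marginal \<mu> p q z))) A" .
qed simp

lemma integral_joint_law_snd:
  fixes f :: "'z \<Rightarrow> real"
  assumes [measurable]: "f \<in> borel_measurable \<nu>"
  shows "(\<integral>(x, z). f z \<partial>joint_law \<mu> \<nu> p q) = (\<integral>z. marginal \<mu> p q z * f z \<partial>\<nu>)"
proof -
  have "(\<integral>(x, z). f z \<partial>joint_law \<mu> \<nu> p q) = (\<integral>z. f z \<partial>distr (joint_law \<mu> \<nu> p q) \<nu> snd)"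
    by (subst integral_distr) (auto simp: case_prod_unfold)
  then show ?thesis
    using marginal_nonneg by (simp add: distr_joint_law_snd integral_density)
qed

lemma integrable_joint_law_snd:
  fixes f :: "'z \<Rightarrow> real"
  assumes [measurable]: "f \<in> borel_measurable \<nu>"
  shows "integrable (joint_law \<mu> \<nu> p q) (\<lambda>(x, z). f z)
    \<longleftrightarrow> integrable \<nu> (\<lambda>z. marginal \<mu> p q z * f z)"
proof -
  have "integrable (joint_law \<mu> \<nu> p q) (\<lambda>(x, z). f z)
      \<longleftrightarrow> integrable (distr (joint_law \<mu> \<nu> p q) \<nu> snd) f"
    by (subst integrable_distr_eq) (auto simp: case_prod_unfold)
  then show ?thesis
    using marginal_nonneg by (simp add: distr_joint_law_snd integrable_density)
qed

section \<open>Almost sure positivity, and nonnegativity of mutual information\<close>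

lemma AE_joint_law_marginal_pos: "AE (x, z) in joint_law \<mu> \<nu> p q. 0 < marginal \<mu> p q z"
proof -
  have "AE z in distr (joint_law \<mu> \<nu> p q) \<nu> snd. 0 < marginal \<mu> p q z"
    \<comment> \<open>The law of \<open>z\<close> has the marginal as its density, so it gives no
      mass to points where the marginal vanishes.\<close>
    unfolding distr_joint_law_snd by (subst AE_density) auto
  then show ?thesis
    by (subst (asm) AE_distr_iff) (auto simp: case_prod_unfold)
qed

lemma AE_joint_law_pos: "AE (x, z) in joint_law \<mu> \<nu> p q. 0 < q x z"
  unfolding joint_law_def
  \<comment> \<open>A positive product \<open>p x * q x z\<close> could also come from two negative
    factors; the sign of \<open>p x\<close> rules this out.\<close>
  by (subst AE_density)
     (auto simp: space_pair_measure zero_less_mult_iff dest: leD[OF p_nonneg] intro!: AE_I2)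

lemma prob_space_joint_law: "prob_space (joint_law \<mu> \<nu> p q)"
proof (rule prob_spaceI)
  have "emeasure (joint_law \<mu> \<nu> p q) (space (joint_law \<mu> \<nu> p q))
      = (\<integral>\<^sup>+w. ennreal (p (fst w) * q (fst w) (snd w)) \<partial>(\<mu> \<Otimes>\<^sub>M \<nu>))"
    by (simp add: joint_law_def emeasure_density case_prod_unfold cong: nn_integral_cong)
  also have "\<dots> = (\<integral>\<^sup>+z. (\<integral>\<^sup>+x. ennreal (p x * q x z) \<partial>\<mu>) \<partial>\<nu>)"
    by (subst nn_integral_snd[symmetric]) (auto simp: case_prod_unfold)
  finally show "emeasure (joint_law \<mu> \<nu> p q) (space (joint_law \<mu> \<nu> p q)) = 1"
    by (simp add: nn_integral_joint)
qed

text \<open>Weighting by the joint density cancels \<open>q x z\<close> and leaves the product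
  density of \<open>p\<close> and the marginal, of total mass 1. Only an inequality results, because
  the product law may charge points where \<open>q x z = 0\<close>.\<close>

lemma nn_integral_marginal_ratio_le:
  "(\<integral>\<^sup>+(x, z). ennreal (marginal \<mu> p q z / q x z) \<partial>joint_law \<mu> \<nu> p q) \<le> 1"
proof -
  have "(\<integral>\<^sup>+(x, z). ennreal (marginal \<mu> p q z / q x z) \<partial>joint_law \<mu> \<nu> p q)
      = (\<integral>\<^sup>+(x, z). ennreal (p x * q x z) * ennreal (marginal \<mu> p q z / q x z) \<partial>(\<mu> \<Otimes>\<^sub>M \<nu>))"
    unfolding joint_law_def by (subst nn_integral_density) (auto simp: case_prod_unfold)
  also have "\<dots> \<le> (\<integral>\<^sup>+(x, z). ennreal (p x) * ennreal (marginal \<mu> p q z) \<partial>(\<mu> \<Otimes>\<^sub>M \<nu>))"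
  proof (intro nn_integral_mono, safe)
    fix x z assume "(x, z) \<in> space (\<mu> \<Otimes>\<^sub>M \<nu>)"
    then have "0 \<le> p x" "0 \<le> q x z" "0 \<le> marginal \<mu> p q z"
      by (auto simp: space_pair_measure p_nonneg q_nonneg marginal_nonneg)
    then show "ennreal (p x * q x z) * ennreal (marginal \<mu> p q z / q x z)
        \<le> ennreal (p x) * ennreal (marginal \<mu> p q z)"
      \<comment> \<open>At \<open>q x z = 0\<close> the left side is 0; otherwise both sides
        agree.\<close>
      by (cases "q x z = 0") (auto simp: ennreal_mult[symmetric])
  qed
  also have "\<dots> = (\<integral>\<^sup>+x. (\<integral>\<^sup>+z. ennreal (p x) * ennreal (marginal \<mu> p q z) \<partial>\<nu>) \<partial>\<mu>)"
    by (subst \<nu>.nn_integral_fst[symmetric]) (auto simp: case_prod_unfold)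
  also have "\<dots> = 1"
    using prob_densityD(3)[OF p] prob_densityD(3)[OF prob_density_marginal]
    by (simp add: nn_integral_cmult)
  finally show ?thesis .
qed

text \<open>Gibbs' inequality: \<open>ln t \<le> t - 1\<close> at
  \<open>t = marginal \<mu> p q z / q x z\<close> bounds the integrand below by
  \<open>1 - t\<close>, whose expectation is nonnegative because \<open>t\<close> has mean at most
  1.\<close>

lemma mutual_info_nonneg:
  assumes int: "integrable (joint_law \<mu> \<nu> p q) (\<lambda>(x, z). ln (q x z / marginal \<mu> p q z))"
  shows "0 \<le> mutual_info \<mu> \<nu> p q"
proof -
  interpret P: prob_space "joint_law \<mu> \<nu> p q"
    by (rule prob_space_joint_law)
  let ?P = "joint_law \<mu> \<nu> p q" and ?h = "\<lambda>(x, z). marginal \<mu> p q z / q x z"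
  have [measurable]: "?h \<in> borel_measurable ?P"
    by (simp add: joint_law_def)
  have nonneg: "AE w in ?P. 0 \<le> ?h w"
    using AE_joint_law_pos AE_joint_law_marginal_pos by eventually_elim auto
  have le1: "(\<integral>\<^sup>+w. ennreal (?h w) \<partial>?P) \<le> 1"
    using nn_integral_marginal_ratio_le by (simp add: case_prod_unfold)
  have int_h: "integrable ?P ?h"
    using nonneg le1 by (intro integrableI_nonneg) (auto intro: le_less_trans)
  have "ennreal (\<integral>w. ?h w \<partial>?P) \<le> 1"
    using le1 nn_integral_eq_integral[OF int_h nonneg] by simp
  then have "0 \<le> (\<integral>w. 1 - ?h w \<partial>?P)"
    using int_h by (simp add: P.prob_space)
  also have "\<dots> \<le> (\<integral>(x, z). ln (q x z / marginal \<mu> p q z) \<partial>?P)"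
  proof (rule integral_mono_AE)
    show "AE w in ?P. 1 - ?h w \<le> (case w of (x, z) \<Rightarrow> ln (q x z / marginal \<mu> p q z))"
      using AE_joint_law_pos AE_joint_law_marginal_pos
    proof eventually_elim
      case (elim w)
      then show ?case
        \<comment> \<open>Inverting the quotient flips the sign of its logarithm; positivity of both
          densities, available almost surely, justifies this.\<close>
        using ln_le_minus_one[of "?h w"] by (auto simp: ln_div split: prod.splits)
    qed
  qed (use int int_h in auto)
  finally show ?thesis
    unfolding mutual_info_def .
qed

end

section \<open>Representations that ignore the state\<close>

lemma marginal_state_independent:
  assumes "prob_density \<mu> p"
  shows "marginal \<mu> p (\<lambda>x. r) = r"
  \<comment> \<open>The factor \<open>r z\<close> leaves the integral and \<open>p\<close>
    integrates to 1, so equality holds at every \<open>z\<close>, not just almost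
    everywhere.\<close>
  using prob_densityD(4,5)[OF assms] by (simp add: marginal_def fun_eq_iff)

text \<open>Where \<open>r z = 0\<close> the quotient is \<open>0 / 0 = 0\<close>, and \<open>ln 0 = 0\<close>.\<close>

lemma mutual_info_state_independent:
  fixes \<mu> :: "'a measure"
  assumes "prob_density \<mu> p"
  shows "mutual_info \<mu> \<nu> p (\<lambda>x. r) = 0"
proof -
  have "(\<lambda>(x :: 'a, z). ln (r z / r z)) = (\<lambda>_. 0)"
    by auto
  then show ?thesis
    unfolding mutual_info_def marginal_state_independent[OF assms] by (simp only: integral_zero)
qed

lemma cond_density_state_independent:
  assumes "prob_density \<nu> r"
  shows "cond_density \<mu> \<nu> (\<lambda>x. r)"
proof -
  have [measurable]: "r \<in> borel_measurable \<nu>"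
    using prob_densityD(1)[OF assms] .
  show ?thesis
    unfolding cond_density_def using assms by auto
qed

section \<open>Comparison of the two objective values\<close>

theorem theorem2:
  fixes \<mu> :: "'x measure" and \<nu> :: "'z measure"
    and p :: "'x \<Rightarrow> real" and q :: "'x \<Rightarrow> 'z \<Rightarrow> real"
    and J :: "'z \<Rightarrow> 'th \<Rightarrow> real" and \<theta> :: 'th and \<beta> :: real
  assumes "sigma_finite_measure \<mu>" and "sigma_finite_measure \<nu>"
    and "\<beta> > 0"
    and "prob_density \<mu> p"
    and "cond_density \<mu> \<nu> q"
    and "(\<lambda>z. J z \<theta>) \<in> borel_measurable \<nu>"
    and "integrable \<nu> (\<lambda>z. marginal \<mu> p q z * exp (1 / \<beta> * J z \<theta>))"
    and "objective_finite \<mu> \<nu> p J \<theta> q"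
    and "objective_finite \<mu> \<nu> p J \<theta> (tilted \<mu> \<nu> p J \<beta> \<theta> q)"
  shows "objective \<mu> \<nu> p J \<beta> \<theta> (tilted \<mu> \<nu> p J \<beta> \<theta> q) \<ge> objective \<mu> \<nu> p J \<beta> \<theta> q"
proof -
  interpret \<mu>: sigma_finite_measure \<mu> by fact
  interpret \<nu>: sigma_finite_measure \<nu> by fact
  interpret old: representation \<mu> \<nu> p q
    by unfold_locales fact+
  define m where "m = marginal \<mu> p q"
  define e where "e = (\<lambda>z. m z * exp (1 / \<beta> * J z \<theta>))"
  define C where "C = (\<integral>z. e z \<partial>\<nu>)"
  define r where "r = (\<lambda>z. e z / C)"
  have tilted: "tilted \<mu> \<nu> p J \<beta> \<theta> q = (\<lambda>x. r)"
    by (simp add: fun_eq_iff tilted_def r_def C_def e_def m_def)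
  have J [measurable]: "(\<lambda>z. J z \<theta>) \<in> borel_measurable \<nu>"
    by fact
  have m: "prob_density \<nu> m"
    unfolding m_def by (rule old.prob_density_marginal)
  have int_e: "integrable \<nu> e"
    using assms(7) by (simp add: e_def m_def)
  have e_nonneg: "0 \<le> e z" if "z \<in> space \<nu>" for z
    using prob_densityD(2)[OF m that] by (simp add: e_def)
  \<comment> \<open>The exponential is positive, so a zero normalizer would force \<open>m\<close>
    to vanish almost everywhere, although it integrates to 1.\<close>
  have "C \<noteq> 0"
  proof
    assume "C = 0"
    then have "AE z in \<nu>. e z = 0"
      using int_e e_nonneg by (subst (asm) C_def, subst (asm) integral_nonneg_eq_0_iff_AE) auto
    then have "AE z in \<nu>. m z = 0"
      by (simp add: e_def)
    then have "(\<integral>z. m z \<partial>\<nu>) = 0"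
      by (rule integral_eq_zero_AE)
    with prob_densityD(5)[OF m] show False
      by simp
  qed
  moreover have "0 \<le> C"
    unfolding C_def using e_nonneg by (intro Bochner_Integration.integral_nonneg)
  ultimately have C: "0 < C"
    by simp
  have r: "prob_density \<nu> r"
  proof (rule prob_densityI_integral)
    show "integrable \<nu> r"
      using int_e by (simp add: r_def)
    show "0 \<le> r z" if "z \<in> space \<nu>" for z
      using e_nonneg[OF that] C by (simp add: r_def)
    have "(\<integral>z. r z \<partial>\<nu>) = C / C"
      unfolding r_def by (simp add: C_def)
    then show "(\<integral>z. r z \<partial>\<nu>) = 1"
      using C by simp
  qed
  \<comment> \<open>The tilted law is a conditional density too, so the reduction to integrals over
    \<open>\<nu>\<close> applies to both representations.\<close>
  interpret new: representation \<mu> \<nu> p "\<lambda>x. r"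
    by unfold_locales (fact assms(4), rule cond_density_state_independent[OF r])
  have marginal_r: "marginal \<mu> p (\<lambda>x. r) = r"
    by (rule marginal_state_independent) fact
  have int_old: "integrable \<nu> (\<lambda>z. m z * J z \<theta>)"
    using assms(8) old.integrable_joint_law_snd[OF J] by (simp add: objective_finite_def m_def)
  have "integrable \<nu> (\<lambda>z. r z * J z \<theta>)"
    using assms(9) new.integrable_joint_law_snd[OF J]
    by (simp add: objective_finite_def tilted marginal_r)
  \<comment> \<open>Multiplying by \<open>C\<close> undoes the normalization and gives integrability
    for \<open>e\<close>, the form that \<open>tilted_mean_ge\<close> takes.\<close>
  then have "integrable \<nu> (\<lambda>z. C * (r z * J z \<theta>))"
    by (rule integrable_mult_right)
  then have int_new: "integrable \<nu> (\<lambda>z. e z * J z \<theta>)"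
    using C by (simp add: r_def)
  have "0 \<le> mutual_info \<mu> \<nu> p q"
    using assms(8) by (intro old.mutual_info_nonneg) (simp add: objective_finite_def)
  \<comment> \<open>Dropping the penalty can only increase the value, as \<open>\<beta>\<close> is
    positive and the mutual information nonnegative.\<close>
  then have "objective \<mu> \<nu> p J \<beta> \<theta> q \<le> (\<integral>z. m z * J z \<theta> \<partial>\<nu>)"
    using \<open>\<beta> > 0\<close> by (simp add: objective_def old.integral_joint_law_snd[OF J] m_def)
  also have "\<dots> \<le> (\<integral>z. e z * J z \<theta> \<partial>\<nu>) / C"
    using tilted_mean_ge[OF m \<open>\<beta> > 0\<close> int_old] int_e int_new C
    by (simp add: e_def C_def pos_le_divide_eq)
  also have "\<dots> = (\<integral>z. r z * J z \<theta> \<partial>\<nu>)"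
    by (simp add: r_def)
  \<comment> \<open>The tilted law pays no penalty, so its objective is exactly the mean of
    \<open>J\<close> under \<open>r\<close>.\<close>
  also have "\<dots> = objective \<mu> \<nu> p J \<beta> \<theta> (tilted \<mu> \<nu> p J \<beta> \<theta> q)"
    unfolding tilted objective_def mutual_info_state_independent[OF assms(4)]
      new.integral_joint_law_snd[OF J] marginal_r
    by simp
  finally show ?thesis .
qed

end
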